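(* Let $S_1$ and $S_2$ be HRAM nets that are structurally equivalent. Then $[\![S_1]\!] =_{\mathbb A} [\![S_2]\!]$.
   Context: Port names and interfaces. Fix disjoint countably infinite sets $\mathbb A$ (port names) and $\mathbb P$ (pointer names). Polarities are $L=\{O,P\}$ with $O^*=P$, $P^*=O$. A port is a pair $(l,a)\in L\times\mathbb A$. An interface is a finite set $A$ of ports in which no port name occurs twice; $\mathrm{sup}(A)$ is its set of port names, and $A^{(O)}$, $A^{(P)}$ are its subsets of $O$- and $P$-labelled ports. For interfaces with disjoint supports $A\otimes B=A\cup B$; $A^*=\{(l^*,a)\mid (l,a)\in A\}$; $A\Rightarrow B=A^*\otimes B$. For a permutation $\pi$ of $\mathbb A$, $\pi\vdash A_1=_{\mathbb A}A_2$ means $\{(l,\pi(a))\mid(l,a)\in A_1\}=A_2$. Machines. Data are $\mathcal D=\{\emptyset\}\cup\mathbb P\cup\mathbb Z$. Fix numbers $r_m\le r$. Instructions (register indices in $\mathbb N\cup\{\emptyset\}$; writing to $\emptyset$ discards, reading $\emptyset$ gives $\emptyset$): $i\leftarrow\mathtt{new}\ j,k$ (allocate a pointer $p$ not in the heap's domain, map it to $(d_j,d_k)$, store $p$ in register $i$); $i,j\leftarrow\mathtt{get}\ k$ (read the pair pointed to by $d_k$ into registers $i,j$); $\mathtt{update}\ i,j$ (set the second component of the pair pointed to by $d_i$ to $d_j$); $\mathtt{free}\ i$ (deallocate $d_i$ and reset register $i$ to $\emptyset$); $\mathtt{flip}\ i,j$ (swap registers $i,j$); $i\leftarrow\mathtt{set}\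 j$ (store constant $j$ in register $i$). Code fragments: $c::=\iota;c\mid\mathtt{ifzero}\ i\ c\ c\mid\mathtt{spark}\ a\mid\mathtt{end}$ with $\iota$ an instruction and $a\in\mathbb A$. An engine $E=(A,P)$ is an interface $A$ with a map $P$ from $\mathrm{sup}(A^{(O)})$ to code fragments such that every $a$ occurring in some $\mathtt{spark}\ a$ in the range of $P$ satisfies $(P,a)\in A$. A thread is a code fragment with an $r$-tuple of data (registers $d_0,\dots,d_{r-1}$); an engine configuration is a finite set of threads and a heap (finite partial map from $\mathbb P$ to $\mathbb P\times\mathcal D$). A message is $(a,\vec d)\in\mathbb A\times\mathcal D^{r_m}$. Engine steps (relative to a connection map $\chi$ on port names): a thread executes its first instruction as described (silent step); $\mathtt{ifzero}\ i\ c_1\ c_2$ continues with $c_1$ if $d_i=0$ and with $c_2$ if $d_i$ is a positive integer, resetting register $i$ to $\emptyset$; $\mathtt{end}$ removes the thread; $\mathtt{spark}\ a$: if $(O,\chi(a))\in A$, the thread is silently replaced by a thread running $P(\chi(a))$ whose registers are the first $r_m$ registers of the old thread padded with $\emptyset$; otherwise the thread is removed and the engine emits output message $(\chi(a),(d_0,\dots,d_{r_m-1}))$. For $(O,a)\in A$ the engine can receive input message $(a,\vec d)$, adding a thread running $P(a)$ with registers $\vec d$ padded with $\emptyset$. Nets. An HRAM net is $S=(\vec E,\chi,A)$: a finite set $\vec E$ of engines whose interfaces have pairwise disjoint supports (and disjoint from $\mathrm{sup}(A)$), an external interface $A$, and a bijection $\chi:\mathrm{sup}(A^{(O)}\otimes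 A_{\vec E}^{(P)})\to\mathrm{sup}(A^{(P)}\otimes A_{\vec E}^{(O)})$, where $A_{\vec E}$ is the tensor of all engine interfaces. A net configuration is a configuration for each engine plus a finite multiset of pending messages; the initial one has no threads, empty heaps and no messages. Net steps: silent engine steps are silent; an engine output adds the message to the multiset (silent); an engine input consumes a matching pending message (silent); for $(P,a)\in A$ a pending message $(a,\vec d)$ can be removed with observable label $(P,(a,\vec d))$; for $(O,a)\in A$ there is an observable step labelled $(O,(a,\vec d))$ that adds $(\chi(a),\vec d)$ to the multiset. A trace over $A$ is a finite sequence of polarised messages $(l,(a,\vec d))$ with $a\in\mathrm{sup}(A)$. The denotation $[\![S]\!]$ is the set of traces $\alpha_1\cdots\alpha_n$ such that from the initial configuration there is a run performing observable steps $\alpha_1,\dots,\alpha_n$ in order, with any number of silent steps interspersed. For sets of traces, $T_1=_{\mathbb A}T_2$ means there is a permutation $\pi$ of $\mathbb A$ with $\{\pi\cdot s\mid s\in T_1\}=T_2$, where $\pi$ renames the port names of messages. Structural equivalence. Nets $f=(\vec E_f,\chi_f,I_f)$ and $g=(\vec E_g,\chi_g,I_g)$ are structurally equivalent if there is a permutation $\pi$ of $\mathbb A$ with $\pi\cdot\vec E_f=\vec E_g$ (renaming port names in interfaces and code), $\pi\vdash I_f=_{\mathbb A}I_g$, and $\chi_g\circ\pi=\pi\circ\chi_f$. *)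

theory Defs
  imports Main "HOL-Library.FSet" "HOL-Library.Finite_Map" "HOL-Library.Multiset"
begin

datatype pname = Port_name nat
datatype pointer = Pointer nat

datatype polarity = Opp | Prop  \<comment> \<open>Opponent and Proponent\<close>

type_synonym port = "polarity \<times> pname"

definition interface :: "port set \<Rightarrow> bool" where
  "interface A \<longleftrightarrow> finite A \<and> inj_on snd A"

definition supp :: "port set \<Rightarrow> pname set" where
  "supp A = snd ` A"

definition pol_part :: "polarity \<Rightarrow> port set \<Rightarrow> port set" where
  "pol_part l A = {p \<in> A. fst p = l}"

definition tensor :: "port set \<Rightarrow> port set \<Rightarrow> port set" where
  "tensor A B = A \<union> B"

definition rename_interface :: "(pname \<Rightarrow> pname) \<Rightarrow> port set \<Rightarrow> port set" where
  "rename_interface \<pi> A = {(l, \<pi> a) |l a. (l, a) \<in> A}"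

definition interface_eq :: "(pname \<Rightarrow> pname) \<Rightarrow> port set \<Rightarrow> port set \<Rightarrow> bool" where
  "interface_eq \<pi> A B \<longleftrightarrow> rename_interface \<pi> A = B"


datatype datum = Null | Ptr pointer | Num int

type_synonym regs = "datum list"
type_synonym heap = "(pointer, pointer \<times> datum) fmap"
type_synonym message = "pname \<times> datum list"

text \<open>The index \<^term>\<open>None\<close> is the dummy register: writing to it discards the value and reading
  it yields \<^term>\<open>Null\<close>.\<close>

type_synonym index = "nat option"

datatype instr =
    New index index index      \<comment> \<open>\<open>i \<leftarrow> new j, k\<close>\<close>
  | Get index index index      \<comment> \<open>\<open>i, j \<leftarrow> get k\<close>\<close>
  | Update index index
  | Free index
  | Flip index index
  | Set_const index datum      \<comment> \<open>\<open>i \<leftarrow> set j\<close>\<close>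

text \<open>The type parameter is the type of port names, so that the generated \<open>map_code\<close> renames
  the port names of a code fragment and \<open>set_code\<close> collects those occurring in it.\<close>

datatype 'a code =
    Seq instr "'a code"
  | Ifzero index "'a code" "'a code"
  | Spark 'a
  | End

record engine =
  iface :: "port set"
  prog :: "pname \<rightharpoonup> pname code"

definition is_engine :: "engine \<Rightarrow> bool" where
  "is_engine E \<longleftrightarrow>
     interface (iface E) \<and>
     dom (prog E) = supp (pol_part Opp (iface E)) \<and>
     (\<forall>c \<in> ran (prog E). \<forall>a \<in> set_code c. (Prop, a) \<in> iface E)"

definition rename_engine :: "(pname \<Rightarrow> pname) \<Rightarrow> engine \<Rightarrow> engine" where
  "rename_engine \<pi> E =
     \<lparr> iface = rename_interface \<pi> (iface E),
       prog = (\<lambda>a. map_option (map_code \<pi>) (prog E (inv \<pi> a))) \<rparr>"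


text \<open>Register access is undefined for an index beyond the number of registers; a thread whose
  next instruction is undefined has no step.\<close>

fun rd :: "regs \<Rightarrow> index \<Rightarrow> datum option" where
  "rd d None = Some Null"
| "rd d (Some i) = (if i < length d then Some (d ! i) else None)"

fun wr :: "regs \<Rightarrow> index \<Rightarrow> datum \<Rightarrow> regs option" where
  "wr d None x = Some d"
| "wr d (Some i) x = (if i < length d then Some (d[i := x]) else None)"

inductive exec :: "instr \<Rightarrow> regs \<times> heap \<Rightarrow> regs \<times> heap \<Rightarrow> bool" where
  new: "rd d j = Some (Ptr q) \<Longrightarrow> rd d k = Some x \<Longrightarrow> p |\<notin>| fmdom h \<Longrightarrow> wr d i (Ptr p) = Some d' \<Longrightarrow>
    exec (New i j k) (d, h) (d', fmupd p (q, x) h)"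
| get: "rd d k = Some (Ptr p) \<Longrightarrow> fmlookup h p = Some (q, x) \<Longrightarrow>
    wr d i (Ptr q) = Some d' \<Longrightarrow> wr d' j x = Some d'' \<Longrightarrow>
    exec (Get i j k) (d, h) (d'', h)"
| update: "rd d i = Some (Ptr p) \<Longrightarrow> rd d j = Some x \<Longrightarrow> fmlookup h p = Some (q, y) \<Longrightarrow>
    exec (Update i j) (d, h) (d, fmupd p (q, x) h)"
| free: "rd d i = Some (Ptr p) \<Longrightarrow> p |\<in>| fmdom h \<Longrightarrow> wr d i Null = Some d' \<Longrightarrow>
    exec (Free i) (d, h) (d', fmdrop p h)"
| flip: "rd d i = Some x \<Longrightarrow> rd d j = Some y \<Longrightarrow> wr d i y = Some d' \<Longrightarrow> wr d' j x = Some d'' \<Longrightarrow>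
    exec (Flip i j) (d, h) (d'', h)"
| set_const: "wr d i x = Some d' \<Longrightarrow> exec (Set_const i x) (d, h) (d', h)"

type_synonym thread = "pname code \<times> regs"
type_synonym engine_config = "thread fset \<times> heap"

datatype label = Silent | Obs "polarity \<times> message"

definition pad :: "nat \<Rightarrow> datum list \<Rightarrow> regs" where
  "pad r d = d @ replicate (r - length d) Null"

inductive engine_step ::
  "nat \<Rightarrow> nat \<Rightarrow> (pname \<rightharpoonup> pname) \<Rightarrow> engine \<Rightarrow> engine_config \<Rightarrow> label \<Rightarrow> engine_config \<Rightarrow> bool"
  for rm r :: nat and \<chi> :: "pname \<rightharpoonup> pname" and E :: engine where
  instr: "(Seq \<iota> c, d) |\<in>| ts \<Longrightarrow> exec \<iota> (d, h) (d', h') \<Longrightarrow>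
    engine_step rm r \<chi> E (ts, h) Silent (finsert (c, d') (ts |-| {|(Seq \<iota> c, d)|}), h')"
| ifzero_zero: "(Ifzero i c\<^sub>1 c\<^sub>2, d) |\<in>| ts \<Longrightarrow> rd d i = Some (Num 0) \<Longrightarrow> wr d i Null = Some d' \<Longrightarrow>
    engine_step rm r \<chi> E (ts, h) Silent (finsert (c\<^sub>1, d') (ts |-| {|(Ifzero i c\<^sub>1 c\<^sub>2, d)|}), h)"
| ifzero_pos: "(Ifzero i c\<^sub>1 c\<^sub>2, d) |\<in>| ts \<Longrightarrow> rd d i = Some (Num n) \<Longrightarrow> 0 < n \<Longrightarrow>
    wr d i Null = Some d' \<Longrightarrow>
    engine_step rm r \<chi> E (ts, h) Silent (finsert (c\<^sub>2, d') (ts |-| {|(Ifzero i c\<^sub>1 c\<^sub>2, d)|}), h)"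
| halt: "(End, d) |\<in>| ts \<Longrightarrow>
    engine_step rm r \<chi> E (ts, h) Silent (ts |-| {|(End, d)|}, h)"
| spark_local: "(Spark a, d) |\<in>| ts \<Longrightarrow> \<chi> a = Some b \<Longrightarrow> (Opp, b) \<in> iface E \<Longrightarrow> prog E b = Some c \<Longrightarrow>
    engine_step rm r \<chi> E (ts, h) Silent
      (finsert (c, pad r (take rm d)) (ts |-| {|(Spark a, d)|}), h)"
| spark_out: "(Spark a, d) |\<in>| ts \<Longrightarrow> \<chi> a = Some b \<Longrightarrow> (Opp, b) \<notin> iface E \<Longrightarrow>
    engine_step rm r \<chi> E (ts, h) (Obs (Prop, (b, take rm d))) (ts |-| {|(Spark a, d)|}, h)"
| receive: "(Opp, a) \<in> iface E \<Longrightarrow> prog E a = Some c \<Longrightarrow> length d = rm \<Longrightarrow>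
    engine_step rm r \<chi> E (ts, h) (Obs (Opp, (a, d))) (finsert (c, pad r d) ts, h)"


record net =
  engines :: "engine set"
  conn :: "pname \<rightharpoonup> pname"
  ext :: "port set"

definition engines_iface :: "engine set \<Rightarrow> port set" where
  "engines_iface Es = (\<Union>E \<in> Es. iface E)"

definition map_bij_betw :: "('a \<rightharpoonup> 'b) \<Rightarrow> 'a set \<Rightarrow> 'b set \<Rightarrow> bool" where
  "map_bij_betw f X Y \<longleftrightarrow> dom f = X \<and> ran f = Y \<and> inj_on f (dom f)"

definition is_net :: "net \<Rightarrow> bool" where
  "is_net S \<longleftrightarrow>
     finite (engines S) \<and>
     (\<forall>E \<in> engines S. is_engine E) \<and>
     pairwise (\<lambda>E F. disjnt (supp (iface E)) (supp (iface F))) (engines S) \<and>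
     (\<forall>E \<in> engines S. disjnt (supp (iface E)) (supp (ext S))) \<and>
     interface (ext S) \<and>
     map_bij_betw (conn S)
       (supp (tensor (pol_part Opp (ext S)) (pol_part Prop (engines_iface (engines S)))))
       (supp (tensor (pol_part Prop (ext S)) (pol_part Opp (engines_iface (engines S)))))"

text \<open>A net configuration assigns a configuration to every value of type \<^typ>\<open>engine\<close>; only those
  of the engines of the net ever change.\<close>

type_synonym net_config = "(engine \<Rightarrow> engine_config) \<times> message multiset"

definition init_config :: net_config where
  "init_config = (\<lambda>_. ({||}, fmempty), {#})"

inductive net_step :: "nat \<Rightarrow> nat \<Rightarrow> net \<Rightarrow> net_config \<Rightarrow> label \<Rightarrow> net_config \<Rightarrow> bool"
  for rm r :: nat and S :: net where
  engine_silent: "E \<in> engines S \<Longrightarrow> engine_step rm r (conn S) E (cs E) Silent c \<Longrightarrow>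
    net_step rm r S (cs, ms) Silent (cs(E := c), ms)"
| engine_out: "E \<in> engines S \<Longrightarrow> engine_step rm r (conn S) E (cs E) (Obs (Prop, m)) c \<Longrightarrow>
    net_step rm r S (cs, ms) Silent (cs(E := c), add_mset m ms)"
| engine_in: "E \<in> engines S \<Longrightarrow> engine_step rm r (conn S) E (cs E) (Obs (Opp, m)) c \<Longrightarrow>
    net_step rm r S (cs, add_mset m ms) Silent (cs(E := c), ms)"
| net_out: "(Prop, a) \<in> ext S \<Longrightarrow>
    net_step rm r S (cs, add_mset (a, d) ms) (Obs (Prop, (a, d))) (cs, ms)"
| net_in: "(Opp, a) \<in> ext S \<Longrightarrow> conn S a = Some b \<Longrightarrow> length d = rm \<Longrightarrow>
    net_step rm r S (cs, ms) (Obs (Opp, (a, d))) (cs, add_mset (b, d) ms)"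


type_synonym trace = "(polarity \<times> message) list"

definition is_trace :: "nat \<Rightarrow> port set \<Rightarrow> trace \<Rightarrow> bool" where
  "is_trace rm A s \<longleftrightarrow> (\<forall>(l, (a, d)) \<in> set s. a \<in> supp A \<and> length d = rm)"

inductive run :: "nat \<Rightarrow> nat \<Rightarrow> net \<Rightarrow> net_config \<Rightarrow> trace \<Rightarrow> net_config \<Rightarrow> bool"
  for rm r :: nat and S :: net where
  refl: "run rm r S n [] n"
| silent: "net_step rm r S n Silent n' \<Longrightarrow> run rm r S n' s n'' \<Longrightarrow> run rm r S n s n''"
| obs: "net_step rm r S n (Obs \<alpha>) n' \<Longrightarrow> run rm r S n' s n'' \<Longrightarrow> run rm r S n (\<alpha> # s) n''"

definition denotation :: "nat \<Rightarrow> nat \<Rightarrow> net \<Rightarrow> trace set" where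
  "denotation rm r S = {s. is_trace rm (ext S) s \<and> (\<exists>n. run rm r S init_config s n)}"

definition rename_trace :: "(pname \<Rightarrow> pname) \<Rightarrow> trace \<Rightarrow> trace" where
  "rename_trace \<pi> s = map (\<lambda>(l, (a, d)). (l, (\<pi> a, d))) s"

definition traces_eq :: "trace set \<Rightarrow> trace set \<Rightarrow> bool" where
  "traces_eq T\<^sub>1 T\<^sub>2 \<longleftrightarrow> (\<exists>\<pi>. bij \<pi> \<and> rename_trace \<pi> ` T\<^sub>1 = T\<^sub>2)"


definition struct_equiv :: "net \<Rightarrow> net \<Rightarrow> bool" where
  "struct_equiv f g \<longleftrightarrow> (\<exists>\<pi>. bij \<pi> \<and>
     rename_engine \<pi> ` engines f = engines g \<and>
     interface_eq \<pi> (ext f) (ext g) \<and>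
     conn g \<circ> \<pi> = map_option \<pi> \<circ> conn f)"

end

(* The operational semantics is equivariant: a permutation of port names that carries one net to
   another also carries each step, hence each run, of the first net to one of the second. So
   renaming maps the traces of S1 into those of S2; since structural equivalence is symmetric
   (invert the permutation), the map is onto. *)
theory Submission
  imports Defs
begin

section \<open>Renaming of interfaces and engines\<close>

lemma rename_interface_image: "rename_interface \<pi> A = map_prod id \<pi> ` A"
  unfolding rename_interface_def by force

lemma mem_rename_interface_iff [simp]:
  "inj \<pi> \<Longrightarrow> (l, \<pi> a) \<in> rename_interface \<pi> A \<longleftrightarrow> (l, a) \<in> A"
  unfolding rename_interface_def by (auto dest: injD)

lemma rename_interface_inv:
  "inj \<pi> \<Longrightarrow> rename_interface (inv \<pi>) (rename_interface \<pi> A) = A"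
  by (simp add: rename_interface_image image_image prod.map_comp prod.map_id)

lemma supp_rename_interface: "supp (rename_interface \<pi> A) = \<pi> ` supp A"
  by (simp add: supp_def rename_interface_image image_image)

text \<open>Stated at \<open>\<pi> a\<close> rather than at an arbitrary name, so that the
  \<open>inv \<pi>\<close> in \<open>rename_engine\<close> cancels.\<close>

lemma prog_rename_engine [simp]:
  "inj \<pi> \<Longrightarrow> prog (rename_engine \<pi> E) (\<pi> a) = map_option (map_code \<pi>) (prog E a)"
  by (simp add: rename_engine_def)

lemma iface_rename_engine [simp]: "iface (rename_engine \<pi> E) = rename_interface \<pi> (iface E)"
  by (simp add: rename_engine_def)

lemma rename_engine_inv:
  assumes "bij \<pi>"
  shows "rename_engine (inv \<pi>) (rename_engine \<pi> E) = E"
  using assms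
  by (simp add: rename_engine_def rename_interface_inv bij_is_inj inv_inv_eq option.map_comp
      code.map_comp o_def code.map_ident option.map_ident)

text \<open>A net configuration is a function on all engines, even those outside the net; carrying
  it along \<open>\<pi>\<close> requires inverting \<open>rename_engine \<pi>\<close>
  everywhere.\<close>

lemma bij_rename_engine:
  assumes "bij \<pi>"
  shows "bij (rename_engine \<pi>)"
proof (rule o_bij)
  show "rename_engine (inv \<pi>) \<circ> rename_engine \<pi> = id"
    using rename_engine_inv [OF assms] by auto
  \<comment> \<open>The previous identity for \<open>inv \<pi>\<close>, whose inverse is
    \<open>\<pi>\<close> again.\<close>
  show "rename_engine \<pi> \<circ> rename_engine (inv \<pi>) = id"
    using rename_engine_inv [OF bij_imp_bij_inv [OF assms]] by (auto simp: inv_inv_eq assms)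
qed

section \<open>Renaming of configurations and traces\<close>

definition rename_thread :: "(pname \<Rightarrow> pname) \<Rightarrow> thread \<Rightarrow> thread" where
  "rename_thread \<pi> = map_prod (map_code \<pi>) id"

definition rename_message :: "(pname \<Rightarrow> pname) \<Rightarrow> message \<Rightarrow> message" where
  "rename_message \<pi> = map_prod \<pi> id"

fun rename_label :: "(pname \<Rightarrow> pname) \<Rightarrow> label \<Rightarrow> label" where
  "rename_label \<pi> Silent = Silent"
| "rename_label \<pi> (Obs (l, m)) = Obs (l, rename_message \<pi> m)"

text \<open>The heap stays fixed because it holds only pointers and data, never port names.\<close>

definition rename_engine_config :: "(pname \<Rightarrow> pname) \<Rightarrow> engine_config \<Rightarrow> engine_config" where
  "rename_engine_config \<pi> = map_prod (fimage (rename_thread \<pi>)) id"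

text \<open>Both values and indices are renamed: a renamed engine holds the renamed configuration of
  the original one.\<close>

definition rename_engine_configs ::
    "(pname \<Rightarrow> pname) \<Rightarrow> (engine \<Rightarrow> engine_config) \<Rightarrow> engine \<Rightarrow> engine_config" where
  "rename_engine_configs \<pi> cs = rename_engine_config \<pi> \<circ> cs \<circ> inv (rename_engine \<pi>)"

definition rename_net_config :: "(pname \<Rightarrow> pname) \<Rightarrow> net_config \<Rightarrow> net_config" where
  "rename_net_config \<pi> = map_prod (rename_engine_configs \<pi>) (image_mset (rename_message \<pi>))"

lemma rename_thread_Pair [simp]: "rename_thread \<pi> (c, d) = (map_code \<pi> c, d)"
  by (simp add: rename_thread_def)

lemma rename_message_Pair [simp]: "rename_message \<pi> (a, d) = (\<pi> a, d)"
  by (simp add: rename_message_def)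

lemma rename_engine_config_Pair [simp]:
  "rename_engine_config \<pi> (ts, h) = (rename_thread \<pi> |`| ts, h)"
  by (simp add: rename_engine_config_def)

lemma rename_net_config_Pair [simp]:
  "rename_net_config \<pi> (cs, ms) =
    (rename_engine_configs \<pi> cs, image_mset (rename_message \<pi>) ms)"
  by (simp add: rename_net_config_def)

lemma rename_engine_configs_apply:
  "bij \<pi> \<Longrightarrow> rename_engine_configs \<pi> cs (rename_engine \<pi> E) = rename_engine_config \<pi> (cs E)"
  by (simp add: rename_engine_configs_def bij_is_inj bij_rename_engine)

text \<open>By bijectivity, \<open>inv (rename_engine \<pi>)\<close> sends only
  \<open>rename_engine \<pi> E\<close> to \<open>E\<close>, so one changed entry yields one changed
  entry.\<close>

lemma rename_engine_configs_upd:
  "bij \<pi> \<Longrightarrow> rename_engine_configs \<pi> (cs(E := c)) =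
    (rename_engine_configs \<pi> cs)(rename_engine \<pi> E := rename_engine_config \<pi> c)"
  using bij_rename_engine [of \<pi>]
  by (auto simp: rename_engine_configs_def fun_eq_iff bij_is_inj bij_is_surj surj_f_inv_f)

text \<open>Threads form a set, so removing one commutes with renaming only if no other thread gets
  the same image.\<close>

lemma inj_rename_thread: "inj \<pi> \<Longrightarrow> inj (rename_thread \<pi>)"
  unfolding rename_thread_def by (intro prod.inj_map code.inj_map inj_on_id)

lemma rename_net_config_init [simp]: "rename_net_config \<pi> init_config = init_config"
  by (simp add: rename_net_config_def rename_engine_configs_def init_config_def fun_eq_iff)

lemma rename_trace_Cons [simp]:
  "rename_trace \<pi> ((l, m) # s) = (l, rename_message \<pi> m) # rename_trace \<pi> s"
  by (cases m) (simp add: rename_trace_def)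

lemma rename_trace_Nil [simp]: "rename_trace \<pi> [] = []"
  by (simp add: rename_trace_def)

lemma rename_trace_rename_trace_inv: "bij \<pi> \<Longrightarrow> rename_trace \<pi> (rename_trace (inv \<pi>) s) = s"
  by (induction s) (auto simp: surj_f_inv_f bij_is_surj)

lemma is_trace_rename_trace:
  "is_trace rm A s \<Longrightarrow> supp A' = \<pi> ` supp A \<Longrightarrow> is_trace rm A' (rename_trace \<pi> s)"
  by (induction s) (auto simp: is_trace_def)

section \<open>Equivariance of engine steps\<close>

lemma fimage_fminus_singleton: "inj f \<Longrightarrow> f |`| (A |-| {|x|}) = f |`| A |-| {|f x|}"
  by (auto dest: injD)

text \<open>Each rule inspects port names only through \<open>\<chi>\<close>, \<open>prog\<close>
  and membership in the interface, all of which renaming respects. Injectivity also preserves the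
  non-membership that makes \<open>spark_out\<close> an output.\<close>

lemma engine_step_rename:
  assumes inj: "inj \<pi>" and conn: "\<And>a. \<chi>' (\<pi> a) = map_option \<pi> (\<chi> a)"
    and step: "engine_step rm r \<chi> E n l n'"
  shows "engine_step rm r \<chi>' (rename_engine \<pi> E)
    (rename_engine_config \<pi> n) (rename_label \<pi> l) (rename_engine_config \<pi> n')"
proof -
  note simps = fimage_fminus_singleton [OF inj_rename_thread [OF inj]] inj conn
  have mem: "rename_thread \<pi> t |\<in>| rename_thread \<pi> |`| ts" if "t |\<in>| ts" for t ts
    using that by simp
  from step show ?thesis
  proof cases
    case (instr \<iota> c d ts h d' h')
    \<comment> \<open>Facts 1 to 3 of each case are the equations for \<open>n\<close>,
      \<open>l\<close> and \<open>n'\<close>; fact 4 is the presence of the active thread.\<close>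
    with mem [OF instr(4)] show ?thesis
      by (simp add: simps engine_step.instr)
  next
    case (ifzero_zero i c\<^sub>1 c\<^sub>2 d ts d' h)
    with mem [OF ifzero_zero(4)] show ?thesis
      by (simp add: simps engine_step.ifzero_zero)
  next
    case (ifzero_pos i c\<^sub>1 c\<^sub>2 d ts n d' h)
    with mem [OF ifzero_pos(4)] show ?thesis
      by (simp add: simps engine_step.ifzero_pos)
  next
    case (halt d ts h)
    with mem [OF halt(4)] show ?thesis
      by (simp add: simps engine_step.halt)
  next
    case (spark_local a d ts b c h)
    with mem [OF spark_local(4)] show ?thesis
      \<comment> \<open>The target port does not occur in the conclusion of the rule, so it is
        supplied.\<close>
      by (simp add: simps engine_step.spark_local [where b = "\<pi> b"])
  next
    case (spark_out a d ts b h)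
    with mem [OF spark_out(4)] show ?thesis
      by (simp add: simps engine_step.spark_out)
  next
    case (receive a c d ts h)
    then show ?thesis
      by (simp add: simps engine_step.receive)
  qed
qed

section \<open>Transport of steps, runs and traces along a renaming of nets, used for both
  \<open>\<pi>\<close> and \<open>inv \<pi>\<close>\<close>

context
  fixes \<pi> :: "pname \<Rightarrow> pname" and S S' :: net
  assumes bij: "bij \<pi>"
    and engines: "rename_engine \<pi> ` engines S = engines S'"
    and ext: "interface_eq \<pi> (ext S) (ext S')"
    and conn: "conn S' \<circ> \<pi> = map_option \<pi> \<circ> conn S"
begin

lemma conn_rename: "conn S' (\<pi> a) = map_option \<pi> (conn S a)"
  using fun_cong [OF conn, of a] by simp

lemma mem_ext_rename: "(l, \<pi> a) \<in> ext S' \<longleftrightarrow> (l, a) \<in> ext S"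
  using mem_rename_interface_iff [OF bij_is_inj [OF bij]] ext
  unfolding interface_eq_def by blast

lemma net_step_rename:
  assumes "net_step rm r S n l n'"
  shows "net_step rm r S' (rename_net_config \<pi> n) (rename_label \<pi> l) (rename_net_config \<pi> n')"
proof -
  have mem: "rename_engine \<pi> E \<in> engines S'" if "E \<in> engines S" for E
    using engines that by blast
  \<comment> \<open>The source is phrased as a value of the renamed assignment, the form that the
    rules of \<open>net_step\<close> expect.\<close>
  have eng: "engine_step rm r (conn S') (rename_engine \<pi> E)
      (rename_engine_configs \<pi> cs (rename_engine \<pi> E)) (rename_label \<pi> l) (rename_engine_config \<pi> c)"
    if "engine_step rm r (conn S) E (cs E) l c" for E cs l c
    using engine_step_rename [OF bij_is_inj [OF bij] conn_rename that]
    by (simp add: rename_engine_configs_apply bij)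
  from assms show ?thesis
  proof cases
    case (engine_silent E cs c ms)
    with mem [of E] eng [of E cs Silent c] show ?thesis
      by (simp add: rename_engine_configs_upd bij net_step.engine_silent)
  next
    case (engine_out E cs m c ms)
    with mem [of E] eng [of E cs "Obs (Prop, m)" c] show ?thesis
      by (simp add: rename_engine_configs_upd bij net_step.engine_out)
  next
    case (engine_in E cs m c ms)
    with mem [of E] eng [of E cs "Obs (Opp, m)" c] show ?thesis
      by (simp add: rename_engine_configs_upd bij net_step.engine_in)
  next
    case (net_out a cs d ms)
    then show ?thesis
      by (simp add: net_step.net_out mem_ext_rename)
  next
    case (net_in a b d cs ms)
    then show ?thesis
      by (simp add: net_step.net_in mem_ext_rename conn_rename)
  qed
qed

lemma run_rename:
  "run rm r S n s n' \<Longrightarrow>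
    run rm r S' (rename_net_config \<pi> n) (rename_trace \<pi> s) (rename_net_config \<pi> n')"
proof (induction rule: run.induct)
  case (refl n)
  show ?case by (simp add: run.refl)
next
  case (silent n n' s n'')
  with net_step_rename [OF silent(1)] show ?case
    by (auto intro: run.silent)
next
  case (obs n \<alpha> n' s n'')
  with net_step_rename [OF obs(1)] show ?case
    \<comment> \<open>The equations for \<open>rename_label\<close> and \<open>rename_trace\<close>
      need the action split into polarity and message.\<close>
    by (cases \<alpha>) (auto intro: run.obs)
qed

lemma rename_trace_denotation:
  assumes "s \<in> denotation rm r S"
  shows "rename_trace \<pi> s \<in> denotation rm r S'"
proof -
  have "supp (ext S') = \<pi> ` supp (ext S)"
    using ext by (simp add: interface_eq_def flip: supp_rename_interface)
  moreover obtain n where "is_trace rm (ext S) s" and run: "run rm r S init_config s n"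
    using assms unfolding denotation_def by blast
  ultimately have "is_trace rm (ext S') (rename_trace \<pi> s)"
    using is_trace_rename_trace by blast
  with run_rename [OF run] show ?thesis
    unfolding denotation_def rename_net_config_init by blast
qed

end

theorem theorem1:
  fixes rm r :: nat and S\<^sub>1 S\<^sub>2 :: net
  assumes "rm \<le> r"
    and "is_net S\<^sub>1" and "is_net S\<^sub>2"
    and "struct_equiv S\<^sub>1 S\<^sub>2"
  shows "traces_eq (denotation rm r S\<^sub>1) (denotation rm r S\<^sub>2)"
proof -
  obtain \<pi> where bij: "bij \<pi>"
    and engines: "rename_engine \<pi> ` engines S\<^sub>1 = engines S\<^sub>2"
    and ext: "interface_eq \<pi> (ext S\<^sub>1) (ext S\<^sub>2)"
    and conn: "conn S\<^sub>2 \<circ> \<pi> = map_option \<pi> \<circ> conn S\<^sub>1"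
    using assms(4) unfolding struct_equiv_def by blast
  \<comment> \<open>The next three facts are the assumptions of the transport context for
    \<open>inv \<pi>\<close>, with the nets exchanged.\<close>
  have "rename_engine (inv \<pi>) ` engines S\<^sub>2 = engines S\<^sub>1"
    by (simp add: image_image rename_engine_inv [OF bij] flip: engines)
  moreover have "interface_eq (inv \<pi>) (ext S\<^sub>2) (ext S\<^sub>1)"
    using ext [unfolded interface_eq_def, symmetric] bij
    by (simp add: interface_eq_def rename_interface_inv bij_is_inj)
  moreover have "conn S\<^sub>1 \<circ> inv \<pi> = map_option (inv \<pi>) \<circ> conn S\<^sub>2"
  proof
    fix b
    \<comment> \<open>Surjectivity of \<open>\<pi>\<close> rewrites \<open>b\<close> as
      \<open>\<pi> (inv \<pi> b)\<close>; injectivity then cancels \<open>\<pi>\<close> in the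
      result.\<close>
    have "conn S\<^sub>2 b = map_option \<pi> (conn S\<^sub>1 (inv \<pi> b))"
      using fun_cong [OF conn, of "inv \<pi> b"] bij by (simp add: bij_is_surj surj_f_inv_f)
    then show "(conn S\<^sub>1 \<circ> inv \<pi>) b = (map_option (inv \<pi>) \<circ> conn S\<^sub>2) b"
      using bij by (simp add: option.map_comp o_def bij_is_inj option.map_ident)
  qed
  ultimately have inv_mem: "rename_trace (inv \<pi>) s \<in> denotation rm r S\<^sub>1"
    if "s \<in> denotation rm r S\<^sub>2" for s
    using rename_trace_denotation [OF bij_imp_bij_inv [OF bij]] that by blast
  have "rename_trace \<pi> ` denotation rm r S\<^sub>1 = denotation rm r S\<^sub>2"
  proof
    show "rename_trace \<pi> ` denotation rm r S\<^sub>1 \<subseteq> denotation rm r S\<^sub>2"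
      using rename_trace_denotation [OF bij engines ext conn] by blast
    \<comment> \<open>The preimage of a trace \<open>s\<close> is
      \<open>rename_trace (inv \<pi>) s\<close>.\<close>
    show "denotation rm r S\<^sub>2 \<subseteq> rename_trace \<pi> ` denotation rm r S\<^sub>1"
      using inv_mem rename_trace_rename_trace_inv [OF bij] by (metis image_eqI subsetI)
  qed
  with bij show ?thesis
    unfolding traces_eq_def by blast
qed

end
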